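(* Let $S=\langle L,\leq,\top,\bot,\Box,\boxtimes\rangle$ be a consistent abstract provability structure and let $\triangle v$ be a one-variable APS term of odd degree. If $p\in L$ is a fixed point of $\triangle v$, then $p$ is not refutable in $S$.
   Context: An abstract provability structure (APS) is a tuple $S=\langle L,\leq,\top,\bot,\Box,\boxtimes\rangle$ where $L$ is a nonempty set, $\leq$ is a partial order on $L$, $\top,\bot\in L$, and $\Box,\boxtimes$ are unary operations on $L$ such that for all $x,y\in L$: (C1) if $x\leq y$ then $\Box x\leq\Box y$ and $\boxtimes y\leq\boxtimes x$; (C2) $\top\leq\boxtimes\bot$; (C3) if $x\leq\Box y$ and $x\leq\boxtimes y$ then $x\leq\boxtimes\top$; (C4) $\boxtimes x\leq\Box\boxtimes x$; (C5) $x\leq\top$. (It is not assumed that $\bot$ is the least element.) $S$ is consistent if $\top\not\leq\bot$. An element $x\in L$ is refutable in $S$ if $x\leq\bot$. A one-variable APS term $\triangle v$ is generated from the variable $v$ by finitely many applications of $\Box$ and $\boxtimes$; it induces a unary operation $x\mapsto\triangle x$ on $L$. The degree $d(\triangle)$ is the number of occurrences of $\boxtimes$ in $\triangle$. A fixed point of $\triangle v$ in $S$ is an element $p\in L$ with $\triangle p=p$. *)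

theory Defs
  imports Main
begin

text \<open>The universe of an abstract provability structure is an explicit carrier set \<open>L\<close>; the order
  and the operations are HOL functions of which only the restriction to \<open>L\<close> matters.
  The least-element property of \<open>ff\<close> is deliberately not assumed.\<close>

locale abstract_provability_structure =
  fixes L :: "'a set"
    and le :: "'a \<Rightarrow> 'a \<Rightarrow> bool"  (infix "\<sqsubseteq>" 50)
    and tt :: 'a
    and ff :: 'a
    and box :: "'a \<Rightarrow> 'a"
    and boxtimes :: "'a \<Rightarrow> 'a"
  assumes nonempty: "L \<noteq> {}"
    and le_refl: "reflp_on L (\<sqsubseteq>)"
    and le_trans: "transp_on L (\<sqsubseteq>)"
    and le_antisym: "antisymp_on L (\<sqsubseteq>)"
    and tt_closed: "tt \<in> L"
    and ff_closed: "ff \<in> L"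
    and box_closed: "\<And>x. x \<in> L \<Longrightarrow> box x \<in> L"
    and boxtimes_closed: "\<And>x. x \<in> L \<Longrightarrow> boxtimes x \<in> L"
    and C1: "\<And>x y. \<lbrakk>x \<in> L; y \<in> L; x \<sqsubseteq> y\<rbrakk> \<Longrightarrow> box x \<sqsubseteq> box y \<and> boxtimes y \<sqsubseteq> boxtimes x"
    and C2: "tt \<sqsubseteq> boxtimes ff"
    and C3: "\<And>x y. \<lbrakk>x \<in> L; y \<in> L; x \<sqsubseteq> box y; x \<sqsubseteq> boxtimes y\<rbrakk> \<Longrightarrow> x \<sqsubseteq> boxtimes tt"
    and C4: "\<And>x. x \<in> L \<Longrightarrow> boxtimes x \<sqsubseteq> box (boxtimes x)"
    and C5: "\<And>x. x \<in> L \<Longrightarrow> x \<sqsubseteq> tt"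

definition aps_consistent :: "('a \<Rightarrow> 'a \<Rightarrow> bool) \<Rightarrow> 'a \<Rightarrow> 'a \<Rightarrow> bool" where
  "aps_consistent le tt ff \<longleftrightarrow> \<not> le tt ff"

definition refutable :: "('a \<Rightarrow> 'a \<Rightarrow> bool) \<Rightarrow> 'a \<Rightarrow> 'a \<Rightarrow> bool" where
  "refutable le ff x \<longleftrightarrow> le x ff"

datatype aps_term = Var | Box aps_term | Boxtimes aps_term

primrec aps_eval :: "('a \<Rightarrow> 'a) \<Rightarrow> ('a \<Rightarrow> 'a) \<Rightarrow> aps_term \<Rightarrow> 'a \<Rightarrow> 'a" where
  "aps_eval box boxtimes Var x = x"
| "aps_eval box boxtimes (Box t) x = box (aps_eval box boxtimes t x)"
| "aps_eval box boxtimes (Boxtimes t) x = boxtimes (aps_eval box boxtimes t x)"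

primrec degree :: "aps_term \<Rightarrow> nat" where
  "degree Var = 0"
| "degree (Box t) = degree t"
| "degree (Boxtimes t) = Suc (degree t)"

definition fixed_point ::
  "'a set \<Rightarrow> ('a \<Rightarrow> 'a) \<Rightarrow> ('a \<Rightarrow> 'a) \<Rightarrow> aps_term \<Rightarrow> 'a \<Rightarrow> bool" where
  "fixed_point L box boxtimes t p \<longleftrightarrow> p \<in> L \<and> aps_eval box boxtimes t p = p"

end

theory Submission
  imports Defs
begin

text \<open>Every value of a term of positive degree lies above \<open>boxtimes tt\<close>. Hence a refutable fixed
  point \<open>p\<close> of such a term makes \<open>boxtimes tt\<close> refutable. But then both operations respect the
  partition of the relevant elements into refutable ones and \<open>tt\<close>: \<open>box\<close> preserves both classes
  and \<open>boxtimes\<close> swaps them. So a term of odd degree sends the refutable \<open>p\<close> to \<open>tt\<close>,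
  whence \<open>p = tt\<close> is refutable.\<close>

context abstract_provability_structure
begin

lemma trans_L: "\<lbrakk>x \<in> L; y \<in> L; z \<in> L; x \<sqsubseteq> y; y \<sqsubseteq> z\<rbrakk> \<Longrightarrow> x \<sqsubseteq> z"
  using le_trans by (blast dest: transp_onD)

lemma refl_L: "x \<in> L \<Longrightarrow> x \<sqsubseteq> x"
  using le_refl by (blast dest: reflp_onD)

lemma eq_tt_if_ge: "\<lbrakk>x \<in> L; tt \<sqsubseteq> x\<rbrakk> \<Longrightarrow> x = tt"
  using le_antisym C5 tt_closed by (blast dest: antisymp_onD)

lemma aps_eval_closed: "x \<in> L \<Longrightarrow> aps_eval box boxtimes t x \<in> L"
  by (induction t) (auto intro: box_closed boxtimes_closed)

text \<open>Antitonicity of \<open>boxtimes\<close> carries C2 from \<open>ff\<close> to everything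
  below it; C5 and antisymmetry turn the bound into an equality.\<close>

lemma boxtimes_refutable:
  assumes "x \<in> L" "x \<sqsubseteq> ff"
  shows "boxtimes x = tt"
proof -
  have "boxtimes ff \<sqsubseteq> boxtimes x" using C1[OF assms(1) ff_closed assms(2)] by simp
  then have "tt \<sqsubseteq> boxtimes x"
    using trans_L[OF tt_closed boxtimes_closed[OF ff_closed] boxtimes_closed[OF assms(1)] C2]
    by simp
  then show ?thesis using eq_tt_if_ge[OF boxtimes_closed[OF assms(1)]] by simp
qed

text \<open>C4 applies because \<open>tt\<close> is itself a \<open>boxtimes\<close> value, namely
  \<open>boxtimes ff\<close>.\<close>

lemma box_tt: "box tt = tt"
proof -
  have "boxtimes ff = tt" using boxtimes_refutable[OF ff_closed refl_L[OF ff_closed]] .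
  then have "tt \<sqsubseteq> box tt" using C4[OF ff_closed] by simp
  then show ?thesis using eq_tt_if_ge[OF box_closed[OF tt_closed]] by simp
qed

lemma box_refutable:
  assumes "x \<in> L" "x \<sqsubseteq> ff"
  shows "box x \<sqsubseteq> boxtimes tt"
proof (rule C3)
  \<comment> \<open>This fixes the open \<open>y\<close> of C3 as \<open>x\<close>, so its other
    premise is mere reflexivity of \<open>box x\<close>.\<close>
  show "box x \<sqsubseteq> boxtimes x" using boxtimes_refutable[OF assms] C5 box_closed assms(1) by simp
qed (use assms box_closed refl_L in auto)

text \<open>The outermost \<open>boxtimes\<close> gives the bound by C5 and antitonicity, whatever
  lies inside it; C4 and monotonicity carry it through each \<open>box\<close> outside.\<close>

lemma boxtimes_tt_le_aps_eval:
  assumes "x \<in> L" "degree t > 0"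
  shows "boxtimes tt \<sqsubseteq> aps_eval box boxtimes t x"
  using assms(2)
proof (induction t)
  case Var
  then show ?case by simp
next
  case (Box t)
  let ?v = "aps_eval box boxtimes t x"
  have v: "?v \<in> L" using aps_eval_closed assms(1) .
  have b: "boxtimes tt \<in> L" using boxtimes_closed tt_closed .
  have "box (boxtimes tt) \<sqsubseteq> box ?v" using Box C1[OF b v] by simp
  then have "boxtimes tt \<sqsubseteq> box ?v"
    using C4[OF tt_closed] trans_L[OF b box_closed[OF b] box_closed[OF v]] by blast
  then show ?case by simp
next
  case (Boxtimes t)
  then show ?case using C1 C5 aps_eval_closed assms(1) tt_closed by simp
qed

text \<open>The bound on \<open>boxtimes tt\<close> enters twice: through
  \<open>box_refutable\<close> at a \<open>box\<close>, and directly when \<open>boxtimes\<close>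
  meets the value \<open>tt\<close>.\<close>

lemma aps_eval_refutable:
  assumes "boxtimes tt \<sqsubseteq> ff" "x \<in> L" "x \<sqsubseteq> ff"
  shows "if even (degree t) then aps_eval box boxtimes t x \<sqsubseteq> ff
         else aps_eval box boxtimes t x = tt"
proof (induction t)
  case Var
  then show ?case using assms by simp
next
  case (Box t)
  let ?v = "aps_eval box boxtimes t x"
  have v: "?v \<in> L" using aps_eval_closed assms(2) .
  have "box ?v \<sqsubseteq> ff" if "?v \<sqsubseteq> ff"
    using trans_L[OF box_closed[OF v] boxtimes_closed[OF tt_closed] ff_closed
        box_refutable[OF v that] assms(1)] .
  then show ?case using Box box_tt by (auto split: if_splits)
next
  case (Boxtimes t)
  then show ?case
    using boxtimes_refutable aps_eval_closed assms(1,2) by (auto split: if_splits)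
qed

lemma odd_fixed_point_not_refutable:
  assumes "\<not> tt \<sqsubseteq> ff" "odd (degree t)" "p \<in> L" "aps_eval box boxtimes t p = p"
  shows "\<not> p \<sqsubseteq> ff"
proof
  assume p: "p \<sqsubseteq> ff"
  have "boxtimes tt \<sqsubseteq> p"
    using boxtimes_tt_le_aps_eval[OF assms(3) odd_pos[OF assms(2)]] assms(4) by simp
  then have "boxtimes tt \<sqsubseteq> ff"
    using trans_L[OF boxtimes_closed[OF tt_closed] assms(3) ff_closed _ p] by simp
  then have "p = tt" using aps_eval_refutable[of p t] p assms by simp
  then show False using p assms(1) by simp
qed

end

theorem theorem6p8:
  fixes L :: "'a set"
    and le :: "'a \<Rightarrow> 'a \<Rightarrow> bool"
    and tt ff :: 'a
    and box boxtimes :: "'a \<Rightarrow> 'a"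
    and t :: aps_term
    and p :: 'a
  assumes "abstract_provability_structure L le tt ff box boxtimes"
    and "aps_consistent le tt ff"
    and "odd (degree t)"
    and "fixed_point L box boxtimes t p"
  shows "\<not> refutable le ff p"
proof -
  interpret abstract_provability_structure L le tt ff box boxtimes by fact
  show ?thesis
    using odd_fixed_point_not_refutable assms(2-4)
    unfolding aps_consistent_def refutable_def fixed_point_def by blast
qed

end
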